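(* Let $0<\alpha<1$, let $\Omega=(a,b)$, let $\kappa$ satisfy $c_0\le\kappa\le c_1$ on $\Omega$ for some positive constants $c_0,c_1$, and let $u$ satisfy $-\partial_x\big(\kappa\,{}_xD_b^{\alpha}u\big)=f$ on $\Omega$ with $u(a)=u(b)=0$. Assume that $f\in C^1(\overline\Omega)$, $\kappa\in C^2(\overline\Omega)$ and $u\in C^3(\overline\Omega)$. Then the truncation error $$T_h^n=\partial_x\big(\kappa\,{}_xD_b^{\alpha}u\big)(x_n)-\frac1{h^2}\Big[\kappa^{n+1/2}\big({}_xI_b^{1-\alpha}\delta u\big)(x_{n})-\kappa^{n-1/2}\big({}_xI_b^{1-\alpha}\delta u\big)(x_{n-1})\Big]$$ satisfies $$T_h^n=O(h)\,\big(1+(b-x_{n-1})^{-\alpha}\big),\qquad 1\le n\le P-1.$$ That is, the truncation error is of order $h$ for $x_n$ not too close to the right boundary.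
   Context: Uniform mesh: $P\ge 2$ is an integer, $h=(b-a)/P$, $x_n=a+nh$ for $0\le n\le P$, $I_n=(x_{n-1},x_n)$, $x_{n+1/2}=(x_n+x_{n+1})/2$, $\kappa^{n+1/2}=\kappa(x_{n+1/2})$, $u^n=u(x_n)$. The backward difference $\delta u$ is the piecewise constant function $\delta u(x)=\delta u^n:=u^n-u^{n-1}$ for $x\in I_n$. The right-sided Riemann–Liouville fractional integral and derivative are ${}_xI_b^{1-\alpha}v(x)=\int_x^b\omega_{1-\alpha}(z-x)v(z)\,dz$ and ${}_xD_b^{\alpha}v(x)=\partial_x\,{}_xI_b^{1-\alpha}v(x)$ (no minus sign), with $\omega_{1-\alpha}(x)=x^{-\alpha}/\Gamma(1-\alpha)$. In the $O(h)$ term the implied constant may depend on $\alpha,a,b,\kappa,u,f$ but not on $n$ or $h$. *)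

theory Defs
  imports "HOL-Analysis.Analysis"
begin

text \<open>
  \<open>Ck_on k g S\<close> means that \<open>g\<close> is of class \<open>C\<^sup>k\<close> on \<open>S\<close>, with \<open>d j\<close> as the \<open>j\<close>-th derivative.
  Derivatives are taken within \<open>S\<close>, so for \<open>S = {a..b}\<close> they are one-sided at the end points and
  \<open>Ck_on k g {a..b}\<close> does not depend on the values of \<open>g\<close> outside \<open>{a..b}\<close>.
\<close>

definition Ck_on :: "nat \<Rightarrow> (real \<Rightarrow> real) \<Rightarrow> real set \<Rightarrow> bool" where
  "Ck_on k g S \<longleftrightarrow>
     (\<exists>d :: nat \<Rightarrow> real \<Rightarrow> real.
        (\<forall>x\<in>S. d 0 x = g x) \<and>
        (\<forall>j<k. \<forall>x\<in>S. (d j has_real_derivative d (Suc j) x) (at x within S)) \<and>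
        continuous_on S (d k))"

definition frac_kernel :: "real \<Rightarrow> real \<Rightarrow> real" where
  "frac_kernel \<beta> x = x powr (\<beta> - 1) / Gamma \<beta>"

text \<open>
  The right-sided Riemann-Liouville integral of order \<open>\<beta>\<close> (to be used for \<open>x \<le> b\<close>). The
  Henstock-Kurzweil integral agrees with the Lebesgue integral whenever the latter exists. The
  kernel has the junk value \<open>0\<close> at its singularity \<open>z = x\<close>, a null set.
\<close>

definition RL_integral_right :: "real \<Rightarrow> real \<Rightarrow> (real \<Rightarrow> real) \<Rightarrow> real \<Rightarrow> real" where
  "RL_integral_right b \<beta> v x = integral {x..b} (\<lambda>z. frac_kernel \<beta> (z - x) * v z)"

text \<open>The sign convention here is that of a plain derivative, without the frequent factor \<open>-1\<close>.\<close>

definition RL_deriv_right :: "real \<Rightarrow> real \<Rightarrow> (real \<Rightarrow> real) \<Rightarrow> real \<Rightarrow> real" where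
  "RL_deriv_right b \<alpha> v x = deriv (RL_integral_right b (1 - \<alpha>) v) x"

definition mesh_size :: "real \<Rightarrow> real \<Rightarrow> nat \<Rightarrow> real" where
  "mesh_size a b P = (b - a) / real P"

definition mesh_node :: "real \<Rightarrow> real \<Rightarrow> nat \<Rightarrow> nat \<Rightarrow> real" where
  "mesh_node a b P n = a + real n * mesh_size a b P"

text \<open>\<open>mesh_mid a b P n\<close> is the midpoint \<open>x\<^bsub>n+1/2\<^esub>\<close> of the cell to the right of the node \<open>x\<^sub>n\<close>.\<close>

definition mesh_mid :: "real \<Rightarrow> real \<Rightarrow> nat \<Rightarrow> nat \<Rightarrow> real" where
  "mesh_mid a b P n = (mesh_node a b P n + mesh_node a b P (n + 1)) / 2"

text \<open>
  The piecewise constant function with value \<open>u(x\<^sub>n) - u(x\<^bsub>n-1\<^esub>)\<close> on the open cell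
  \<open>(x\<^bsub>n-1\<^esub>, x\<^sub>n)\<close>. At the nodes and outside the mesh it is \<open>0\<close>, which does not affect its
  integrals over subintervals of \<open>{a..b}\<close>.
\<close>

definition backward_diff :: "real \<Rightarrow> real \<Rightarrow> nat \<Rightarrow> (real \<Rightarrow> real) \<Rightarrow> real \<Rightarrow> real" where
  "backward_diff a b P u x =
     (\<Sum>n=1..P. (u (mesh_node a b P n) - u (mesh_node a b P (n - 1))) *
               indicat_real {mesh_node a b P (n - 1)<..<mesh_node a b P n} x)"

text \<open>
  To be used for \<open>1 \<le> n < P\<close>, so that \<open>n - 1\<close> is not truncated and \<open>mesh_mid a b P (n - 1)\<close> is
  \<open>x\<^bsub>n-1/2\<^esub>\<close>.
\<close>

definition truncation_error ::
  "real \<Rightarrow> real \<Rightarrow> real \<Rightarrow> (real \<Rightarrow> real) \<Rightarrow> (real \<Rightarrow> real) \<Rightarrow> nat \<Rightarrow> nat \<Rightarrow> real" where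
  "truncation_error \<alpha> a b \<kappa> u P n =
     deriv (\<lambda>x. \<kappa> x * RL_deriv_right b \<alpha> u x) (mesh_node a b P n)
     - 1 / (mesh_size a b P)\<^sup>2 *
       (\<kappa> (mesh_mid a b P n) *
          RL_integral_right b (1 - \<alpha>) (backward_diff a b P u) (mesh_node a b P n)
        - \<kappa> (mesh_mid a b P (n - 1)) *
          RL_integral_right b (1 - \<alpha>) (backward_diff a b P u) (mesh_node a b P (n - 1)))"

end

theory Submission
  imports Defs
begin

text \<open>
  Since \<open>u b = 0\<close>, the fractional derivative of \<open>u\<close> is the fractional integral
  \<open>w = I u'\<close>, where \<open>I\<close> is the right-sided integral of order \<open>1 - \<alpha>\<close>
  (\<open>RL_integral_right_has_derivative\<close>). Fractional integrals of smooth functions are in general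
  not differentiable at \<open>b\<close>, but here the differential equation helps: the flux \<open>G = \<kappa> w\<close> has derivative
  \<open>- f\<close>, so \<open>w = G / \<kappa>\<close> has a bounded and Lipschitz continuous derivative on the whole interval
  (\<open>quotient_derivative_lipschitz\<close>).

  Write \<open>h\<close> for the mesh size and \<open>E\<^sub>n\<close> for the difference between \<open>w\<close> at the midpoint to the
  right of \<open>x\<^sub>n\<close> and \<open>I (\<delta>u / h)\<close> at \<open>x\<^sub>n\<close>. The truncation error is the sum of the error of the
  centred difference quotient of \<open>G\<close> at \<open>x\<^sub>n\<close>, which is \<open>O(h)\<close> because \<open>G' = - f\<close> is Lipschitz,
  and of \<open>(\<kappa>\<^sub>+ E\<^sub>n - \<kappa>\<^sub>- E\<^bsub>n-1\<^esub>) / h\<close>, with \<open>\<kappa>\<^sub>+\<close> and \<open>\<kappa>\<^sub>-\<close> the values at the two midpoints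
  next to \<open>x\<^sub>n\<close>. As \<open>\<kappa>\<^sub>+ - \<kappa>\<^sub>- = O(h)\<close>, it is enough that \<open>E\<^bsub>n-1\<^esub> = O(h)\<close> and that the increment
  \<open>E\<^sub>n - E\<^bsub>n-1\<^esub>\<close> is \<open>O(h\<^sup>2) (1 + (b - x\<^bsub>n-1\<^esub>)\<^sup>-\<^sup>\<alpha>)\<close>.

  Each \<open>E\<^sub>n\<close> consists of the increment of \<open>w\<close> over half a cell and of \<open>I e\<close> at \<open>x\<^sub>n\<close>, where
  \<open>e = u' - \<delta>u / h\<close> (\<open>slope_error\<close>). The increments of \<open>w\<close> are of size \<open>O(h)\<close>, and they change
  by \<open>O(h\<^sup>2)\<close> from one cell to the next, because \<open>w'\<close> is bounded and Lipschitz. The function \<open>e\<close>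
  is \<open>O(h)\<close> and in general no better, as it varies within a cell as much as \<open>u'\<close> does. Its values at points that are one cell apart do agree up to
  \<open>O(h\<^sup>2)\<close> (\<open>slope_error_shift_bound\<close>). As \<open>I\<close> commutes with translations except for the mass
  that the translation moves across \<open>b\<close> (\<open>RL_integral_right_shift_bound\<close>), the increment of \<open>I e\<close>
  over one cell is \<open>O(h\<^sup>2)\<close> plus the integral of \<open>e = O(h)\<close> over one last cell of length \<open>h\<close>,
  against a kernel of size \<open>(b - x\<^sub>n)\<^sup>-\<^sup>\<alpha>\<close>. This last term is where the boundary weight comes from.
\<close>


section \<open>Mean value estimates\<close>

lemma mean_value_interior:
  fixes g g' :: "real \<Rightarrow> real"
  assumes "p < q" "continuous_on {p..q} g"
    and "\<And>z. p < z \<Longrightarrow> z < q \<Longrightarrow> (g has_real_derivative g' z) (at z)"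
  obtains z where "p < z" "z < q" "g q - g p = (q - p) * g' z"
proof -
  obtain l z where z: "p < z" "z < q" "DERIV g z :> l" "g q - g p = (q - p) * l"
    using MVT[OF assms(1,2)] assms(3) by (metis real_differentiable_def)
  moreover have "l = g' z"
    using z assms(3) DERIV_unique by blast
  ultimately show ?thesis
    using that by blast
qed

lemma mean_value_within:
  fixes g g' :: "real \<Rightarrow> real"
  assumes g: "\<And>z. z \<in> {a..b} \<Longrightarrow> (g has_real_derivative g' z) (at z within {a..b})"
    and "a \<le> p" "p < q" "q \<le> b"
  obtains z where "p < z" "z < q" "g q - g p = (q - p) * g' z"
proof (rule mean_value_interior[OF \<open>p < q\<close>])
  show "continuous_on {p..q} g"
    using assms DERIV_continuous_on[OF g] by (auto intro: continuous_on_subset)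
  show "(g has_real_derivative g' z) (at z)" if "p < z" "z < q" for z
    using g[of z] that assms by (simp add: at_within_Icc_at)
qed

text \<open>
  A second difference with two independent steps. Only continuity is asked for at the end points,
  so that the estimate also covers a first cell that starts at \<open>a\<close>, where a two-sided derivative
  is not available.
\<close>

lemma shift_difference_bound:
  fixes g g' :: "real \<Rightarrow> real"
  assumes "p \<le> q" "0 \<le> t"
    and cont: "continuous_on {p..q + t} g"
    and der: "\<And>z. p < z \<Longrightarrow> z < q + t \<Longrightarrow> (g has_real_derivative g' z) (at z)"
    and lip: "M-lipschitz_on {p<..<q + t} g'"
  shows "\<bar>(g (q + t) - g q) - (g (p + t) - g p)\<bar> \<le> M * t * (q - p)"
proof (cases "p = q")
  case False
  obtain z where z: "p < z" "z < q"
    "(g (q + t) - g q) - (g (p + t) - g p) = (q - p) * (g' (z + t) - g' z)"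
  proof (rule mean_value_interior[where g = "\<lambda>z. g (z + t) - g z" and p = p and q = q])
    show "continuous_on {p..q} (\<lambda>z. g (z + t) - g z)"
      using \<open>0 \<le> t\<close>
      by (intro continuous_on_diff continuous_on_subset[OF cont]
          continuous_on_compose2[OF cont]) (auto intro!: continuous_intros)
    show "((\<lambda>z. g (z + t) - g z) has_real_derivative g' (z + t) - g' z) (at z)"
      if "p < z" "z < q" for z
      using that \<open>0 \<le> t\<close> der[of z] der[of "z + t"]
      by (intro DERIV_diff) (auto simp: DERIV_shift)
  qed (use False assms in auto)
  have "\<bar>g' (z + t) - g' z\<bar> \<le> M * t"
    using lipschitz_onD[OF lip, of "z + t" z] z \<open>0 \<le> t\<close> by (auto simp: dist_real_def)
  then show ?thesis
    using z by (simp add: abs_mult mult.commute[of "q - p"] mult_right_mono)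
qed simp

lemma divided_difference_error:
  fixes g g' :: "real \<Rightarrow> real"
  assumes "0 < h" "y \<in> {p..p + h}"
    and der: "\<And>z. z \<in> {p..p + h} \<Longrightarrow> (g has_real_derivative g' z) (at z within {p..p + h})"
    and osc: "\<And>z. z \<in> {p..p + h} \<Longrightarrow> \<bar>g' y - g' z\<bar> \<le> A"
  shows "\<bar>g' y - (g (p + h) - g p) / h\<bar> \<le> A"
proof -
  obtain z where "p < z" "z < p + h" "g (p + h) - g p = (p + h - p) * g' z"
    using mean_value_within[OF der, of p "p + h"] \<open>0 < h\<close> by auto
  then show ?thesis
    using osc[of z] \<open>0 < h\<close> by simp
qed

text \<open>
  Differentiability from a quantitative first-order expansion. It avoids differentiating under a
  singular integral.
\<close>

lemma quadratic_remainder_imp_derivative: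
  fixes F :: "real \<Rightarrow> real"
  assumes "l < x" "x < r"
    and "\<And>y. l < y \<Longrightarrow> y < r \<Longrightarrow> \<bar>F y - F x - (y - x) * D\<bar> \<le> K * (y - x)\<^sup>2"
  shows "(F has_real_derivative D) (at x)"
proof -
  have ev: "\<forall>\<^sub>F y in at x. \<bar>(F y - F x) / (y - x) - D\<bar> \<le> \<bar>y - x\<bar> * K"
  proof (rule eventually_at_in_open'[of "{l<..<r}", THEN eventually_rev_mp])
    show "\<forall>\<^sub>F y in at x. y \<in> {l<..<r} \<longrightarrow> \<bar>(F y - F x) / (y - x) - D\<bar> \<le> \<bar>y - x\<bar> * K"
      unfolding eventually_at_filter
    proof (intro always_eventually allI impI)
      fix y assume y: "y \<noteq> x" "y \<in> {l<..<r}"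
      have "\<bar>(F y - F x) / (y - x) - D\<bar> = \<bar>F y - F x - (y - x) * D\<bar> / \<bar>y - x\<bar>"
        using y by (simp add: field_simps flip: abs_divide)
      also have "\<dots> \<le> K * (y - x)\<^sup>2 / \<bar>y - x\<bar>"
        using assms y by (intro divide_right_mono) auto
      also have "\<dots> = \<bar>y - x\<bar> * K"
        using y by (simp add: field_simps power2_eq_square flip: abs_mult)
      finally show "\<bar>(F y - F x) / (y - x) - D\<bar> \<le> \<bar>y - x\<bar> * K" .
    qed
  qed (use assms in auto)
  have "((\<lambda>y. y - x) \<longlongrightarrow> 0) (at x)"
    using LIM_zero[of "\<lambda>y. y" x "at x"] by simp
  then have "((\<lambda>y. (F y - F x) / (y - x) - D) \<longlongrightarrow> 0) (at x)"
    by (rule tendsto_0_le[where K = K]) (use ev in simp)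
  then show ?thesis
    unfolding has_field_derivative_iff by (rule LIM_zero_cancel)
qed

lemma product_difference_bound:
  fixes k1 k2 e1 e2 :: real
  assumes "\<bar>k2\<bar> \<le> c" "\<bar>e2 - e1\<bar> \<le> A" "\<bar>k2 - k1\<bar> \<le> K" "\<bar>e1\<bar> \<le> B"
  shows "\<bar>k2 * e2 - k1 * e1\<bar> \<le> c * A + K * B"
proof -
  have "k2 * e2 - k1 * e1 = k2 * (e2 - e1) + (k2 - k1) * e1"
    by (simp add: algebra_simps)
  also have "\<bar>\<dots>\<bar> \<le> \<bar>k2\<bar> * \<bar>e2 - e1\<bar> + \<bar>k2 - k1\<bar> * \<bar>e1\<bar>"
    by (metis abs_mult abs_triangle_ineq)
  also have "\<dots> \<le> c * A + K * B"
    using assms by (intro add_mono mult_mono) auto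
  finally show ?thesis .
qed

section \<open>Bounded Lipschitz functions\<close>

text \<open>
  Unlike Lipschitz continuity alone, the combination with boundedness is stable under products.
  This is the regularity that the flux and its quotient by \<open>\<kappa>\<close> inherit from the data. It can be
  stated on the open interval, where the equation holds, without extending anything to the end
  points.
\<close>

definition bounded_lipschitz :: "real set \<Rightarrow> (real \<Rightarrow> real) \<Rightarrow> bool" where
  "bounded_lipschitz S g \<longleftrightarrow> (\<exists>L. L-lipschitz_on S g) \<and> bounded (g ` S)"

lemma bounded_lipschitzE:
  assumes "bounded_lipschitz S g"
  obtains L where "0 \<le> L" "L-lipschitz_on S g" "\<And>x. x \<in> S \<Longrightarrow> \<bar>g x\<bar> \<le> L"
proof -
  obtain K B where "K-lipschitz_on S g" "\<And>x. x \<in> S \<Longrightarrow> \<bar>g x\<bar> \<le> B"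
    using assms unfolding bounded_lipschitz_def bounded_iff by auto
  then have "(max K B)-lipschitz_on S g" "\<And>x. x \<in> S \<Longrightarrow> \<bar>g x\<bar> \<le> max K B" "0 \<le> max K B"
    using lipschitz_on_nonneg[of K S g] by (auto intro: lipschitz_on_mono max.coboundedI2)
  then show ?thesis
    using that by blast
qed

lemma bounded_lipschitzI:
  assumes "bounded S" "\<And>x y. x \<in> S \<Longrightarrow> y \<in> S \<Longrightarrow> \<bar>g x - g y\<bar> \<le> L * \<bar>x - y\<bar>"
  shows "bounded_lipschitz S g"
proof -
  have "(max L 0)-lipschitz_on S g"
    unfolding lipschitz_on_def dist_real_def
    using assms(2) by (meson abs_ge_zero max.cobounded1 max.cobounded2 mult_right_mono order_trans)
  then show ?thesis
    unfolding bounded_lipschitz_def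
    using assms(1) lipschitz_on_uniformly_continuous bounded_uniformly_continuous_image by blast
qed

lemma bounded_lipschitz_subset:
  "bounded_lipschitz T g \<Longrightarrow> S \<subseteq> T \<Longrightarrow> bounded_lipschitz S g"
  unfolding bounded_lipschitz_def by (meson bounded_subset image_mono lipschitz_on_subset)

lemma bounded_lipschitz_minus:
  "bounded_lipschitz S g \<Longrightarrow> bounded_lipschitz S (\<lambda>x. - g x)"
  unfolding bounded_lipschitz_def by (auto simp: bounded_iff)

lemma bounded_lipschitz_add:
  "bounded_lipschitz S f \<Longrightarrow> bounded_lipschitz S g \<Longrightarrow> bounded_lipschitz S (\<lambda>x. f x + g x)"
  unfolding bounded_lipschitz_def by (auto intro: lipschitz_on_add bounded_plus_comp)

lemma bounded_lipschitz_mult: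
  assumes "bounded S" "bounded_lipschitz S f" "bounded_lipschitz S g"
  shows "bounded_lipschitz S (\<lambda>x. f x * g x)"
proof -
  obtain L where L: "0 \<le> L" "L-lipschitz_on S f" "\<And>x. x \<in> S \<Longrightarrow> \<bar>f x\<bar> \<le> L"
    using bounded_lipschitzE assms(2) by blast
  obtain M where M: "0 \<le> M" "M-lipschitz_on S g" "\<And>x. x \<in> S \<Longrightarrow> \<bar>g x\<bar> \<le> M"
    using bounded_lipschitzE assms(3) by blast
  show ?thesis
  proof (rule bounded_lipschitzI[OF assms(1)])
    fix x y assume xy: "x \<in> S" "y \<in> S"
    have "f x * g x - f y * g y = f x * (g x - g y) + (f x - f y) * g y"
      by (simp add: algebra_simps)
    also have "\<bar>\<dots>\<bar> \<le> \<bar>f x\<bar> * \<bar>g x - g y\<bar> + \<bar>f x - f y\<bar> * \<bar>g y\<bar>"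
      by (metis abs_mult abs_triangle_ineq)
    also have "\<dots> \<le> L * (M * \<bar>x - y\<bar>) + (L * \<bar>x - y\<bar>) * M"
      using L M xy lipschitz_onD[OF L(2) xy] lipschitz_onD[OF M(2) xy]
      by (intro add_mono mult_mono) (auto simp: dist_real_def)
    finally show "\<bar>f x * g x - f y * g y\<bar> \<le> (2 * L * M) * \<bar>x - y\<bar>"
      by (simp add: algebra_simps)
  qed
qed

lemma bounded_lipschitz_inverse:
  assumes "bounded S" "bounded_lipschitz S g" "0 < c" "\<And>x. x \<in> S \<Longrightarrow> c \<le> g x"
  shows "bounded_lipschitz S (\<lambda>x. inverse (g x))"
proof -
  obtain L where L: "0 \<le> L" "L-lipschitz_on S g"
    using bounded_lipschitzE assms(2) by blast
  show ?thesis
  proof (rule bounded_lipschitzI[OF assms(1)])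
    fix x y assume xy: "x \<in> S" "y \<in> S"
    have pos: "0 < g x" "0 < g y" "c \<le> g x" "c \<le> g y"
      using xy assms by (force intro: less_le_trans)+
    have "\<bar>inverse (g x) - inverse (g y)\<bar> = \<bar>g x - g y\<bar> / (g x * g y)"
      using pos by (simp add: inverse_eq_divide abs_minus_commute diff_frac_eq abs_mult)
    also have "\<dots> \<le> (L * \<bar>x - y\<bar>) / (c * c)"
      using pos \<open>0 < c\<close> lipschitz_onD[OF L(2) xy] L
      by (intro frac_le mult_mono) (auto simp: dist_real_def)
    finally show "\<bar>inverse (g x) - inverse (g y)\<bar> \<le> (L / (c * c)) * \<bar>x - y\<bar>"
      by simp
  qed
qed

lemma bounded_lipschitz_derivative:
  assumes "convex S" "bounded S"
    and "\<And>x. x \<in> S \<Longrightarrow> (g has_real_derivative g' x) (at x within S)"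
    and "bounded (g' ` S)"
  shows "bounded_lipschitz S g"
proof -
  obtain B where "\<And>x. x \<in> S \<Longrightarrow> norm (g' x) \<le> B"
    using assms(4) unfolding bounded_iff by auto
  then have "norm (g x - g y) \<le> B * norm (x - y)" if "x \<in> S" "y \<in> S" for x y
    using field_differentiable_bound[OF assms(1,3)] that by blast
  then show ?thesis
    using bounded_lipschitzI[OF assms(2)] by (metis real_norm_def)
qed

lemma bounded_lipschitz_C1:
  assumes "\<And>x. x \<in> {a..b} \<Longrightarrow> (g has_real_derivative g' x) (at x within {a..b})"
    and "continuous_on {a..b} g'"
  shows "bounded_lipschitz {a..b} g"
  using assms
  by (intro bounded_lipschitz_derivative) (auto intro!: compact_imp_bounded compact_continuous_image)

lemma Ck_on_derivative:
  assumes "Ck_on (Suc k) g S"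
  obtains g' where "\<And>x. x \<in> S \<Longrightarrow> (g has_real_derivative g' x) (at x within S)" "Ck_on k g' S"
proof -
  obtain d where d: "\<And>x. x \<in> S \<Longrightarrow> d 0 x = g x"
    "\<And>j x. j < Suc k \<Longrightarrow> x \<in> S \<Longrightarrow> (d j has_real_derivative d (Suc j) x) (at x within S)"
    "continuous_on S (d (Suc k))"
    using assms unfolding Ck_on_def by blast
  have "(g has_real_derivative d 1 x) (at x within S)" if "x \<in> S" for x
    using d(2)[of 0 x] that d(1)
    by (auto intro: has_field_derivative_transform_within[OF _ zero_less_one])
  moreover have "Ck_on k (d 1) S"
    unfolding Ck_on_def using d by (intro exI[of _ "\<lambda>j. d (Suc j)"]) auto
  ultimately show ?thesis
    using that by blast
qed

lemma Ck_on_0: "Ck_on 0 g S \<Longrightarrow> continuous_on S g"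
  unfolding Ck_on_def by (metis continuous_on_cong)

text \<open>
  A continuous derivative is bounded on a compact interval.
\<close>

lemma Ck_on_Suc_bounded_lipschitz:
  assumes "Ck_on (Suc k) g {a..b}"
  shows "bounded_lipschitz {a..b} g"
proof -
  obtain g' where g': "\<And>x. x \<in> {a..b} \<Longrightarrow> (g has_real_derivative g' x) (at x within {a..b})"
    and Ck: "Ck_on k g' {a..b}"
    using Ck_on_derivative[OF assms] by blast
  have "continuous_on {a..b} g'"
  proof (cases k)
    case 0
    then show ?thesis using Ck Ck_on_0 by blast
  next
    case (Suc m)
    then show ?thesis using Ck Ck_on_derivative DERIV_continuous_on by metis
  qed
  then show ?thesis
    using bounded_lipschitz_C1 g' by blast
qed

text \<open>
  The gain of regularity from the equation, with \<open>w\<close> the fractional derivative and \<open>G = \<kappa> w\<close> the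
  flux: \<open>w' = g / \<kappa> - G \<kappa>' / \<kappa>\<^sup>2\<close> is built from bounded Lipschitz functions by sums and products.
  No property of fractional integrals enters, which is why the estimate for \<open>w'\<close> does not
  deteriorate at \<open>b\<close>.
\<close>

lemma quotient_derivative_lipschitz:
  fixes \<kappa> \<kappa>' G g w :: "real \<Rightarrow> real"
  assumes "0 < c" "\<And>x. x \<in> {a<..<b} \<Longrightarrow> c \<le> \<kappa> x"
    and \<kappa>: "\<And>x. x \<in> {a<..<b} \<Longrightarrow> (\<kappa> has_real_derivative \<kappa>' x) (at x)"
    and bl: "bounded_lipschitz {a<..<b} \<kappa>" "bounded_lipschitz {a<..<b} \<kappa>'"
    and G: "\<And>x. x \<in> {a<..<b} \<Longrightarrow> (G has_real_derivative g x) (at x)"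
    and g: "bounded_lipschitz {a<..<b} g"
    and w: "\<And>x. x \<in> {a<..<b} \<Longrightarrow> G x = \<kappa> x * w x"
  obtains w' where "\<And>x. x \<in> {a<..<b} \<Longrightarrow> (w has_real_derivative w' x) (at x)"
    "bounded_lipschitz {a<..<b} w'"
proof
  define w' where "w' = (\<lambda>x. g x * inverse (\<kappa> x) + - (G x * (\<kappa>' x * (inverse (\<kappa> x) * inverse (\<kappa> x)))))"
  have G_bl: "bounded_lipschitz {a<..<b} G"
    using g by (intro bounded_lipschitz_derivative[where g' = g])
      (auto simp: bounded_lipschitz_def intro!: has_field_derivative_at_within[OF G])
  have inv: "bounded_lipschitz {a<..<b} (\<lambda>x. inverse (\<kappa> x))"
    by (rule bounded_lipschitz_inverse[OF _ bl(1) assms(1,2)]) auto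
  show "bounded_lipschitz {a<..<b} w'"
    unfolding w'_def
    by (intro bounded_lipschitz_add bounded_lipschitz_minus bounded_lipschitz_mult inv g G_bl bl) auto
  show "(w has_real_derivative w' x) (at x)" if x: "x \<in> {a<..<b}" for x
  proof (rule has_field_derivative_transform_within_open[where S = "{a<..<b}"])
    have "\<kappa> x \<noteq> 0"
      using assms(1) assms(2)[OF x] by auto
    then show "((\<lambda>y. G y * inverse (\<kappa> y)) has_real_derivative w' x) (at x)"
      using x by (auto intro!: derivative_eq_intros \<kappa> G simp: w'_def power2_eq_square)
    show "G y * inverse (\<kappa> y) = w y" if "y \<in> {a<..<b}" for y
      using assms(1) assms(2)[OF that] w[OF that] by simp
  qed (use x in auto)
qed

section \<open>The fractional kernel\<close>

text \<open>
  A class that contains the continuous functions and the step functions on an interval, and whose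
  members have integrable products with the singular kernel.
\<close>

definition bounded_measurable :: "real set \<Rightarrow> (real \<Rightarrow> real) \<Rightarrow> bool" where
  "bounded_measurable S g \<longleftrightarrow> g \<in> borel_measurable (lebesgue_on S) \<and> bounded (g ` S)"

lemma bounded_measurable_continuous:
  assumes "continuous_on {a..b} g"
  shows "bounded_measurable {a..b} g"
  unfolding bounded_measurable_def
  using assms
  by (auto intro!: continuous_imp_measurable_on_sets_lebesgue compact_imp_bounded
      compact_continuous_image)

lemma bounded_measurable_add:
  assumes "bounded_measurable S g" "bounded_measurable S k"
  shows "bounded_measurable S (\<lambda>x. g x + k x)"
  using assms unfolding bounded_measurable_def
  by (auto intro!: bounded_plus_comp)

lemma bounded_measurable_cmult:
  assumes "bounded_measurable S g"
  shows "bounded_measurable S (\<lambda>x. c * g x)"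
proof -
  have "bounded ((*) c ` g ` S)"
    by (rule bounded_linear_image) (use assms in \<open>auto simp: bounded_measurable_def bounded_linear_mult_right\<close>)
  then show ?thesis
    using assms unfolding bounded_measurable_def by (auto simp: image_image)
qed

lemma bounded_measurable_sum:
  assumes "\<And>i. i \<in> I \<Longrightarrow> bounded_measurable S (g i)"
  shows "bounded_measurable S (\<lambda>x. \<Sum>i\<in>I. g i x)"
  using assms
proof (induction I rule: infinite_finite_induct)
  case (insert i I)
  then show ?case
    using bounded_measurable_add[of S "g i" "\<lambda>x. \<Sum>i\<in>I. g i x"] by simp
qed (auto simp: bounded_measurable_def bounded_iff)

lemma bounded_measurable_indicator:
  assumes "T \<in> sets borel"
  shows "bounded_measurable S (indicat_real T)"
  unfolding bounded_measurable_def
proof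
  show "indicat_real T \<in> borel_measurable (lebesgue_on S)"
    using assms by (intro measurable_restrict_space1 borel_measurable_indicator) auto
  show "bounded (indicat_real T ` S)"
    by (auto simp: bounded_iff indicator_def intro!: exI[of _ 1])
qed

lemma frac_kernel_nonneg: "0 < \<beta> \<Longrightarrow> 0 \<le> frac_kernel \<beta> x"
  by (simp add: frac_kernel_def)

lemma frac_kernel_antimono:
  "0 < \<beta> \<Longrightarrow> \<beta> \<le> 1 \<Longrightarrow> 0 < r \<Longrightarrow> r \<le> s \<Longrightarrow> frac_kernel \<beta> s \<le> frac_kernel \<beta> r"
  by (auto simp: frac_kernel_def intro!: divide_right_mono powr_mono2')

text \<open>
  On the mesh, \<open>r = b - x\<^sub>n\<close> is at least one cell, so that \<open>s = b - x\<^bsub>n-1\<^esub>\<close> is at most twice as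
  large. This turns the weight at \<open>x\<^sub>n\<close> into the weight at \<open>x\<^bsub>n-1\<^esub>\<close>.
\<close>

lemma frac_kernel_distance_doubling:
  assumes "0 < \<alpha>" "\<alpha> < 1" "0 < r" "s \<le> 2 * r" "r \<le> s"
  shows "frac_kernel (1 - \<alpha>) r \<le> 2 / Gamma (1 - \<alpha>) * s powr (- \<alpha>)"
proof -
  have "r powr (- \<alpha>) \<le> (s / 2) powr (- \<alpha>)"
    using assms by (intro powr_mono2') auto
  also have "\<dots> = 2 powr \<alpha> * s powr (- \<alpha>)"
    using assms by (simp add: powr_divide powr_minus field_simps)
  also have "\<dots> \<le> 2 powr 1 * s powr (- \<alpha>)"
    using assms by (intro mult_right_mono powr_mono) auto
  finally show ?thesis
    using assms by (simp add: frac_kernel_def divide_right_mono)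
qed

lemma frac_kernel_has_integral:
  assumes "0 < \<beta>" "x \<le> y"
  shows "((\<lambda>z. frac_kernel \<beta> (z - x)) has_integral frac_kernel (\<beta> + 1) (y - x)) {x..y}"
proof -
  have "((\<lambda>s. s powr (\<beta> - 1)) has_integral ((y - x) powr (\<beta> - 1 + 1) / (\<beta> - 1 + 1))) {0..y - x}"
    using assms by (intro has_integral_powr_from_0) auto
  then have "((\<lambda>s. frac_kernel \<beta> s) has_integral ((y - x) powr \<beta> / \<beta>) / Gamma \<beta>) {0..y - x}"
    unfolding frac_kernel_def by (intro has_integral_divide) simp
  moreover have "((y - x) powr \<beta> / \<beta>) / Gamma \<beta> = frac_kernel (\<beta> + 1) (y - x)"
  proof -
    have "\<beta> \<notin> \<int>\<^sub>\<le>\<^sub>0"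
      using assms(1) nonpos_Ints_nonpos[of \<beta>] by auto
    then show ?thesis
      by (simp add: frac_kernel_def Gamma_plus1)
  qed
  ultimately show ?thesis
    using has_integral_shift_real_ivl[of "frac_kernel \<beta>" _ 0 "y - x" "- x"] by simp
qed

lemma frac_kernel_mult_integrable:
  assumes "0 < \<beta>" "a \<le> x" "x \<le> b" "bounded_measurable {a..b} g"
  shows "(\<lambda>z. frac_kernel \<beta> (z - x) * g z) integrable_on {x..b}"
proof -
  have "(\<lambda>z. frac_kernel \<beta> (z - x)) absolutely_integrable_on {x..b}"
    using frac_kernel_has_integral[OF assms(1,3)] assms(1)
    by (intro nonnegative_absolutely_integrable_1) (auto simp: frac_kernel_nonneg)
  moreover have "{x..b} \<subseteq> {a..b}"
    using assms by auto
  then have "g \<in> borel_measurable (lebesgue_on {x..b})" "bounded (g ` {x..b})"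
    using assms(4) unfolding bounded_measurable_def
    by (auto intro: measurable_restrict_mono bounded_subset[OF _ image_mono])
  ultimately have "(\<lambda>z. g z * frac_kernel \<beta> (z - x)) absolutely_integrable_on {x..b}"
    by (intro absolutely_integrable_bounded_measurable_product_real) auto
  then show ?thesis
    by (simp add: mult.commute absolutely_integrable_on_def)
qed

text \<open>
  The finite exceptional set \<open>N\<close> is meant for the mesh nodes: there the backward difference is \<open>0\<close>,
  whatever the slope of \<open>u\<close>.
\<close>

lemma frac_kernel_weighted_integral_bound:
  assumes "0 < \<beta>" "x \<le> y" "finite N" "0 \<le> A"
    and int: "(\<lambda>z. frac_kernel \<beta> (z - x) * g z) integrable_on {x..y}"
    and bnd: "\<And>z. z \<in> {x..y} - N \<Longrightarrow> \<bar>g z\<bar> \<le> A"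
  shows "\<bar>integral {x..y} (\<lambda>z. frac_kernel \<beta> (z - x) * g z)\<bar> \<le> A * frac_kernel (\<beta> + 1) (y - x)"
proof -
  \<comment> \<open>Removing the exceptional points makes the bound hold everywhere.\<close>
  define g' where "g' = (\<lambda>z. if z \<in> N then 0 else g z)"
  have eq: "frac_kernel \<beta> (z - x) * g' z = frac_kernel \<beta> (z - x) * g z" if "z \<in> {x..y} - N" for z
    using that by (simp add: g'_def)
  have int': "(\<lambda>z. frac_kernel \<beta> (z - x) * g' z) integrable_on {x..y}"
    by (rule integrable_spike_finite[OF \<open>finite N\<close> eq int])
  have ker: "((\<lambda>z. A * frac_kernel \<beta> (z - x)) has_integral A * frac_kernel (\<beta> + 1) (y - x)) {x..y}"
    by (intro has_integral_mult_right frac_kernel_has_integral assms)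
  have "norm (integral {x..y} (\<lambda>z. frac_kernel \<beta> (z - x) * g' z))
      \<le> integral {x..y} (\<lambda>z. A * frac_kernel \<beta> (z - x))"
  proof (rule integral_norm_bound_integral[OF int'])
    show "norm (frac_kernel \<beta> (z - x) * g' z) \<le> A * frac_kernel \<beta> (z - x)" if "z \<in> {x..y}" for z
      using that bnd[of z] \<open>0 \<le> A\<close> frac_kernel_nonneg[OF assms(1), of "z - x"]
      by (auto simp: g'_def abs_mult mult.commute[of A] intro!: mult_left_mono)
  qed (use ker in auto)
  moreover have "integral {x..y} (\<lambda>z. frac_kernel \<beta> (z - x) * g' z)
      = integral {x..y} (\<lambda>z. frac_kernel \<beta> (z - x) * g z)"
    by (intro integral_spike[OF negligible_finite[OF \<open>finite N\<close>]]) (simp add: eq)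
  ultimately show ?thesis
    unfolding integral_unique[OF ker] real_norm_def by (simp only:)
qed

section \<open>Fractional integrals and their derivatives\<close>

lemma RL_integral_right_add:
  assumes "0 < \<beta>" "a \<le> x" "x \<le> b" "bounded_measurable {a..b} g" "bounded_measurable {a..b} k"
  shows "RL_integral_right b \<beta> (\<lambda>z. g z + k z) x
    = RL_integral_right b \<beta> g x + RL_integral_right b \<beta> k x"
  unfolding RL_integral_right_def
  by (simp add: distrib_left integral_add frac_kernel_mult_integrable[OF assms(1-3)] assms(4,5))

lemma RL_integral_right_cmult:
  "RL_integral_right b \<beta> (\<lambda>z. c * g z) x = c * RL_integral_right b \<beta> g x"
  unfolding RL_integral_right_def
  by (simp add: mult.left_commute)

lemma RL_integral_right_bound:
  assumes "0 < \<beta>" "a \<le> x" "x \<le> b" "bounded_measurable {a..b} g" "finite N" "0 \<le> A"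
    and bnd: "\<And>z. z \<in> {a..b} - N \<Longrightarrow> \<bar>g z\<bar> \<le> A"
  shows "\<bar>RL_integral_right b \<beta> g x\<bar> \<le> A * frac_kernel (\<beta> + 1) (b - a)"
proof -
  have "\<bar>RL_integral_right b \<beta> g x\<bar> \<le> A * frac_kernel (\<beta> + 1) (b - x)"
    unfolding RL_integral_right_def
    using assms by (intro frac_kernel_weighted_integral_bound frac_kernel_mult_integrable) auto
  also have "frac_kernel (\<beta> + 1) (b - x) \<le> frac_kernel (\<beta> + 1) (b - a)"
    using assms by (auto simp: frac_kernel_def intro!: divide_right_mono powr_mono2)
  finally show ?thesis
    using \<open>0 \<le> A\<close> by (simp add: mult_left_mono)
qed

text \<open>
  After the substitution \<open>z \<mapsto> z + t\<close> the integral of \<open>g\<close> from \<open>x + t\<close> has the same kernel as that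
  of \<open>k\<close> from \<open>x\<close>, but it ends at \<open>b - t\<close>. On the common interval the difference \<open>A\<close> of the
  integrands is multiplied by the mass of the kernel. The remaining interval \<open>{b - t..b}\<close> has
  length \<open>t\<close>, and there the decreasing kernel is at most its value at distance \<open>b - t - x\<close> from its
  singularity. With \<open>k = g\<close> the lemma controls the increments of a fractional integral, and with
  \<open>k = g + t g'\<close> the remainder of its first-order expansion.
\<close>

lemma RL_integral_right_shift_bound:
  assumes \<beta>: "0 < \<beta>" "\<beta> \<le> 1"
    and x: "a \<le> x" "0 \<le> t" "x + t < b"
    and meas: "bounded_measurable {a..b} g" "bounded_measurable {a..b} k"
    and N: "finite N" and nonneg: "0 \<le> A" "0 \<le> B"
    and diff: "\<And>z. z \<in> {x..b - t} - N \<Longrightarrow> \<bar>g (z + t) - k z\<bar> \<le> A"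
    and tail: "\<And>z. z \<in> {b - t..b} - N \<Longrightarrow> \<bar>k z\<bar> \<le> B"
  shows "\<bar>RL_integral_right b \<beta> g (x + t) - RL_integral_right b \<beta> k x\<bar>
    \<le> A * frac_kernel (\<beta> + 1) (b - a) + B * t * frac_kernel \<beta> (b - t - x)"
proof -
  let ?K = "\<lambda>z. frac_kernel \<beta> (z - x)"
  have int_g: "(\<lambda>z. frac_kernel \<beta> (z - (x + t)) * g z) integrable_on {x + t..b}"
    using x by (intro frac_kernel_mult_integrable[OF \<beta>(1) _ _ meas(1)]) auto
  have int_k: "(\<lambda>z. ?K z * k z) integrable_on {x..b}"
    using x by (intro frac_kernel_mult_integrable[OF \<beta>(1) _ _ meas(2)]) auto
  have int_g': "(\<lambda>z. ?K z * g (z + t)) integrable_on {x..b - t}"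
    using integrable_shift_real_ivl[OF int_g, of t] by simp
  have int_k1: "(\<lambda>z. ?K z * k z) integrable_on {x..b - t}"
    and int_k2: "(\<lambda>z. ?K z * k z) integrable_on {b - t..b}"
    using x by (auto intro: integrable_subinterval_real[OF int_k])
  have "RL_integral_right b \<beta> g (x + t) = integral {x..b - t} (\<lambda>z. ?K z * g (z + t))"
    using integral_shift_real_ivl[of "x + t" t b "\<lambda>z. frac_kernel \<beta> (z - (x + t)) * g z"]
    by (simp add: RL_integral_right_def)
  moreover have "RL_integral_right b \<beta> k x
      = integral {x..b - t} (\<lambda>z. ?K z * k z) + integral {b - t..b} (\<lambda>z. ?K z * k z)"
    unfolding RL_integral_right_def using x by (intro Henstock_Kurzweil_Integration.integral_combine[OF _ _ int_k, symmetric]) auto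
  ultimately have split: "RL_integral_right b \<beta> g (x + t) - RL_integral_right b \<beta> k x
      = integral {x..b - t} (\<lambda>z. ?K z * (g (z + t) - k z)) - integral {b - t..b} (\<lambda>z. ?K z * k z)"
    by (simp add: right_diff_distrib integral_diff int_g' int_k1)
  have "\<bar>integral {x..b - t} (\<lambda>z. ?K z * (g (z + t) - k z))\<bar> \<le> A * frac_kernel (\<beta> + 1) (b - t - x)"
    using x diff N nonneg \<beta> int_g' int_k1
    by (intro frac_kernel_weighted_integral_bound[where N = N])
      (auto simp: right_diff_distrib integrable_diff)
  also have "\<dots> \<le> A * frac_kernel (\<beta> + 1) (b - a)"
    using x \<beta> nonneg
    by (auto simp: frac_kernel_def intro!: mult_left_mono divide_right_mono powr_mono2)
  finally have main: "\<bar>integral {x..b - t} (\<lambda>z. ?K z * (g (z + t) - k z))\<bar>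
      \<le> A * frac_kernel (\<beta> + 1) (b - a)" .
  have "norm (integral {b - t..b} (\<lambda>z. ?K z * k z))
      \<le> (frac_kernel \<beta> (b - t - x) * B) * measure lborel (cbox (b - t) b)"
  proof (rule has_integral_bound_spike_finite[OF _ N])
    show "((\<lambda>z. ?K z * k z) has_integral integral {b - t..b} (\<lambda>z. ?K z * k z)) (cbox (b - t) b)"
      using int_k2 by auto
    show "norm (?K z * k z) \<le> frac_kernel \<beta> (b - t - x) * B" if "z \<in> cbox (b - t) b - N" for z
    proof -
      have "?K z \<le> frac_kernel \<beta> (b - t - x)"
        using that x \<beta> by (intro frac_kernel_antimono) auto
      then show ?thesis
        using that tail[of z] nonneg frac_kernel_nonneg[OF \<beta>(1)]
        by (auto simp: abs_mult intro!: mult_mono)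
    qed
  qed (use nonneg frac_kernel_nonneg[OF \<beta>(1)] in auto)
  also have "\<dots> = B * t * frac_kernel \<beta> (b - t - x)"
    using x by simp
  finally show ?thesis
    using main unfolding split by simp
qed

text \<open>
  For \<open>\<beta> < 1\<close> no constant works up to \<open>b\<close> if \<open>g b \<noteq> 0\<close>: near \<open>b\<close> the integral behaves like a
  multiple of the power \<open>\<beta>\<close> of the distance to \<open>b\<close>.
\<close>

lemma RL_integral_right_lipschitz:
  assumes \<beta>: "0 < \<beta>" "\<beta> \<le> 1" and "c < b"
    and lip: "M-lipschitz_on {a..b} g" and bnd: "\<And>z. z \<in> {a..b} \<Longrightarrow> \<bar>g z\<bar> \<le> M"
  shows "(M * frac_kernel (\<beta> + 1) (b - a) + M * frac_kernel \<beta> (b - c))-lipschitz_on {a..c}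
    (RL_integral_right b \<beta> g)"
proof (rule lipschitz_on_leI)
  have M: "0 \<le> M"
    using lip by (rule lipschitz_on_nonneg)
  then show "0 \<le> M * frac_kernel (\<beta> + 1) (b - a) + M * frac_kernel \<beta> (b - c)"
    using \<beta> by (simp add: frac_kernel_nonneg)
  fix x y assume xy: "x \<in> {a..c}" "y \<in> {a..c}" "x \<le> y"
  define t where "t = y - x"
  have meas: "bounded_measurable {a..b} g"
    using lip by (intro bounded_measurable_continuous lipschitz_on_continuous_on)
  have "\<bar>RL_integral_right b \<beta> g (x + t) - RL_integral_right b \<beta> g x\<bar>
      \<le> (M * t) * frac_kernel (\<beta> + 1) (b - a) + M * t * frac_kernel \<beta> (b - t - x)"
  proof (rule RL_integral_right_shift_bound[where N = "{}", OF \<beta> _ _ _ meas meas])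
    show "\<bar>g (z + t) - g z\<bar> \<le> M * t" if "z \<in> {x..b - t} - {}" for z
      using lipschitz_onD[OF lip, of "z + t" z] that xy by (auto simp: t_def dist_real_def)
  qed (use xy bnd M \<open>c < b\<close> in \<open>auto simp: t_def\<close>)
  also have "\<dots> \<le> (M * t) * frac_kernel (\<beta> + 1) (b - a) + M * t * frac_kernel \<beta> (b - c)"
    using M xy \<beta> \<open>c < b\<close>
    by (intro add_left_mono mult_left_mono frac_kernel_antimono) (auto simp: t_def)
  finally show "dist (RL_integral_right b \<beta> g x) (RL_integral_right b \<beta> g y)
      \<le> (M * frac_kernel (\<beta> + 1) (b - a) + M * frac_kernel \<beta> (b - c)) * dist x y"
    using xy by (simp add: dist_real_def t_def algebra_simps abs_minus_commute)
qed

text \<open>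
  By the first-order expansion of \<open>g\<close>, comparing the integral of \<open>g\<close> from \<open>p + t\<close> with that of
  \<open>g + t g'\<close> from \<open>p\<close> leaves an error of order \<open>t\<^sup>2\<close>. In the last piece, of length \<open>t\<close>, this uses
  \<open>g b = 0\<close>, which makes \<open>g + t g'\<close> of order \<open>t\<close> near \<open>b\<close>. The expansion is at the left one of
  the two points; to differentiate from the left at \<open>x\<close>, the Lipschitz continuity of the integral
  of \<open>g'\<close> moves the base point.
\<close>

lemma RL_integral_right_has_derivative:
  fixes g g' :: "real \<Rightarrow> real"
  assumes \<beta>: "0 < \<beta>" "\<beta> \<le> 1" and x: "a < x" "x < b" and "g b = 0"
    and der: "\<And>z. z \<in> {a..b} \<Longrightarrow> (g has_real_derivative g' z) (at z within {a..b})"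
    and "bounded_lipschitz {a..b} g'"
  shows "(RL_integral_right b \<beta> g has_real_derivative RL_integral_right b \<beta> g' x) (at x)"
proof -
  let ?I = "RL_integral_right b \<beta>"
  obtain M where M: "0 \<le> M" "M-lipschitz_on {a..b} g'" "\<And>z. z \<in> {a..b} \<Longrightarrow> \<bar>g' z\<bar> \<le> M"
    using bounded_lipschitzE assms(7) by blast
  have meas: "bounded_measurable {a..b} g" "bounded_measurable {a..b} g'"
    using DERIV_continuous_on[OF der] lipschitz_on_continuous_on[OF M(2)]
    by (auto intro: bounded_measurable_continuous)
  \<comment> \<open>Points up to \<open>c\<close> keep a fixed distance from the singularity at \<open>b\<close>.\<close>
  define c where "c = (x + b) / 2"
  have "c < b"
    using x by (simp add: c_def)
  define C where "C = M * frac_kernel (\<beta> + 1) (b - a) + 2 * M * frac_kernel \<beta> (b - c)"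
  define L where "L = M * frac_kernel (\<beta> + 1) (b - a) + M * frac_kernel \<beta> (b - c)"
  have L: "L-lipschitz_on {a..c} (?I g')"
    unfolding L_def by (rule RL_integral_right_lipschitz[OF \<beta> \<open>c < b\<close> M(2,3)])
  have CL: "0 \<le> C" "0 \<le> L"
    using M \<beta> by (auto simp: C_def L_def frac_kernel_nonneg)
  have one_sided: "\<bar>?I g (p + t) - ?I g p - t * ?I g' p\<bar> \<le> C * t\<^sup>2"
    if "a \<le> p" "0 \<le> t" "p + t < c" for p t
  proof -
    have lt: "p + t < b"
      using that \<open>c < b\<close> by simp
    have sum: "?I (\<lambda>z. g z + t * g' z) p = ?I g p + t * ?I g' p"
      using RL_integral_right_add[OF \<beta>(1), of a p b g "\<lambda>z. t * g' z"] that lt meas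
      by (simp add: RL_integral_right_cmult bounded_measurable_cmult)
    have "\<bar>?I g (p + t) - ?I (\<lambda>z. g z + t * g' z) p\<bar>
        \<le> (M * t\<^sup>2) * frac_kernel (\<beta> + 1) (b - a) + (2 * M * t) * t * frac_kernel \<beta> (b - t - p)"
    proof (rule RL_integral_right_shift_bound[where N = "{}", OF \<beta>])
      fix z assume z: "z \<in> {p..b - t} - {}"
      show "\<bar>g (z + t) - (g z + t * g' z)\<bar> \<le> M * t\<^sup>2"
      proof (cases "t = 0")
        case False
        then have "a \<le> z" "z < z + t" "z + t \<le> b"
          using z that by auto
        then obtain s where s: "z < s" "s < z + t" "g (z + t) - g z = (z + t - z) * g' s"
          using mean_value_within[OF der] by blast
        have "\<bar>g' s - g' z\<bar> \<le> M * \<bar>s - z\<bar>"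
          using lipschitz_onD[OF M(2), of s z] s z that by (auto simp: dist_real_def)
        also have "\<dots> \<le> M * t"
          using s M by (intro mult_left_mono) auto
        finally have "t * \<bar>g' s - g' z\<bar> \<le> t * (M * t)"
          using that by (intro mult_left_mono)
        moreover have "g (z + t) - (g z + t * g' z) = t * (g' s - g' z)"
          using s by (simp add: algebra_simps)
        ultimately show ?thesis
          using that by (simp add: abs_mult power2_eq_square mult.left_commute)
      qed simp
    next
      fix z assume z: "z \<in> {b - t..b} - {}"
      have "\<bar>g z\<bar> \<le> t * M"
      proof (cases "z = b")
        case False
        then have "a \<le> z" "z < b" "b \<le> b"
          using z that lt by auto
        then obtain s where s: "z < s" "s < b" "g b - g z = (b - z) * g' s"
          using mean_value_within[OF der] by blast
        have "(b - z) * \<bar>g' s\<bar> \<le> t * M"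
          using z s that M lt by (intro mult_mono) auto
        moreover have "\<bar>g z\<bar> = (b - z) * \<bar>g' s\<bar>"
          using s \<open>g b = 0\<close> by (metis abs_minus_cancel abs_mult abs_of_pos diff_0 diff_gt_0_iff_gt less_trans)
        ultimately show ?thesis
          by simp
      qed (use \<open>g b = 0\<close> that M in simp)
      moreover have "t * \<bar>g' z\<bar> \<le> t * M"
        using M z that lt by (intro mult_left_mono) auto
      moreover have "\<bar>g z + t * g' z\<bar> \<le> \<bar>g z\<bar> + t * \<bar>g' z\<bar>"
        using that abs_triangle_ineq[of "g z" "t * g' z"] by (simp add: abs_mult)
      ultimately show "\<bar>g z + t * g' z\<bar> \<le> 2 * M * t"
        by (simp add: mult.commute[of t M])
    qed (use that lt M meas in \<open>auto intro: bounded_measurable_add bounded_measurable_cmult\<close>)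
    also have "\<dots> \<le> (M * t\<^sup>2) * frac_kernel (\<beta> + 1) (b - a) + (2 * M * t) * t * frac_kernel \<beta> (b - c)"
      using that M \<beta> \<open>c < b\<close>
      by (intro add_left_mono mult_left_mono frac_kernel_antimono) auto
    also have "\<dots> = C * t\<^sup>2"
      by (simp add: C_def power2_eq_square algebra_simps)
    finally show ?thesis
      by (simp add: sum diff_diff_eq)
  qed
  show ?thesis
  proof (rule quadratic_remainder_imp_derivative)
    show "a < x" "x < c"
      using x by (auto simp: c_def)
    fix y assume y: "a < y" "y < c"
    show "\<bar>?I g y - ?I g x - (y - x) * ?I g' x\<bar> \<le> (C + L) * (y - x)\<^sup>2"
    proof (cases "x \<le> y")
      case True
      then have "\<bar>?I g y - ?I g x - (y - x) * ?I g' x\<bar> \<le> C * (y - x)\<^sup>2"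
        using one_sided[of x "y - x"] x y by simp
      then show ?thesis
        using CL by (simp add: distrib_right add_increasing2)
    next
      case False
      then have 1: "\<bar>?I g x - ?I g y - (x - y) * ?I g' y\<bar> \<le> C * (x - y)\<^sup>2"
        using one_sided[of y "x - y"] x y \<open>x < c\<close> by simp
      have "\<bar>?I g' x - ?I g' y\<bar> \<le> L * (x - y)"
        using lipschitz_onD[OF L, of x y] x y \<open>x < c\<close> False by (simp add: dist_real_def)
      then have "(x - y) * \<bar>?I g' x - ?I g' y\<bar> \<le> (x - y) * (L * (x - y))"
        using False by (intro mult_left_mono) auto
      then have 2: "\<bar>(x - y) * (?I g' x - ?I g' y)\<bar> \<le> L * (x - y)\<^sup>2"
        using False by (simp add: abs_mult power2_eq_square mult.left_commute)
      have "?I g y - ?I g x - (y - x) * ?I g' x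
          = - (?I g x - ?I g y - (x - y) * ?I g' y) + (x - y) * (?I g' x - ?I g' y)"
        by (simp add: algebra_simps)
      then show ?thesis
        using 1 2 by (simp add: distrib_right power2_commute[of y x])
    qed
  qed
qed

section \<open>The uniform mesh and the backward difference\<close>

lemma mesh_size_pos: "a < b \<Longrightarrow> 0 < P \<Longrightarrow> 0 < mesh_size a b P"
  by (simp add: mesh_size_def)

lemma mesh_node_0: "mesh_node a b P 0 = a"
  by (simp add: mesh_node_def)

lemma mesh_node_P: "0 < P \<Longrightarrow> mesh_node a b P P = b"
  by (simp add: mesh_node_def mesh_size_def)

lemma mesh_node_Suc: "mesh_node a b P (Suc n) = mesh_node a b P n + mesh_size a b P"
  by (simp add: mesh_node_def algebra_simps)

lemma mesh_node_less_iff: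
  "a < b \<Longrightarrow> 0 < P \<Longrightarrow> mesh_node a b P m < mesh_node a b P n \<longleftrightarrow> m < n"
  using mesh_size_pos[of a b P] by (simp add: mesh_node_def)

lemma mesh_node_le_iff:
  "a < b \<Longrightarrow> 0 < P \<Longrightarrow> mesh_node a b P m \<le> mesh_node a b P n \<longleftrightarrow> m \<le> n"
  using mesh_node_less_iff[of a b P n m] by (metis linorder_not_less)

lemma mesh_cell_exists:
  assumes "a < b" "0 < P" "y \<in> {a..b}" "y \<notin> mesh_node a b P ` {..P}"
  obtains j where "j < P" "mesh_node a b P j < y" "y < mesh_node a b P (Suc j)"
proof -
  have pos: "0 < mesh_size a b P"
    using assms by (simp add: mesh_size_pos)
  define r where "r = (y - a) / mesh_size a b P"
  define j where "j = nat \<lfloor>r\<rfloor>"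
  have y: "y = a + r * mesh_size a b P"
    using pos by (simp add: r_def)
  have "0 \<le> r"
    using pos assms(3) by (simp add: r_def)
  then have j: "real j \<le> r" "r < real j + 1"
    by (simp_all add: j_def)
  have le: "mesh_node a b P j \<le> y" and less: "y < mesh_node a b P (Suc j)"
    using j pos by (simp_all add: y mesh_node_def)
  have "y \<noteq> b"
    using assms(2,4) mesh_node_P[of P a b] by force
  then have "mesh_node a b P j < mesh_node a b P P"
    using le assms(2,3) by (simp add: mesh_node_P)
  then have "j < P"
    using mesh_node_less_iff assms by blast
  moreover have "mesh_node a b P j \<noteq> y"
    using \<open>j < P\<close> assms(4) by force
  ultimately show ?thesis
    using that le less by simp
qed

lemma backward_diff_cell:
  assumes "a < b" "j < P" "mesh_node a b P j < y" "y < mesh_node a b P (Suc j)"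
  shows "backward_diff a b P u y = u (mesh_node a b P (Suc j)) - u (mesh_node a b P j)"
proof -
  have "indicat_real {mesh_node a b P (n - 1)<..<mesh_node a b P n} y = 0"
    if "n \<noteq> Suc j" "1 \<le> n" for n
  proof -
    have "n \<le> j \<or> Suc j \<le> n - 1"
      using that by auto
    then have "mesh_node a b P n \<le> mesh_node a b P j
        \<or> mesh_node a b P (Suc j) \<le> mesh_node a b P (n - 1)"
      using assms(1,2) by (simp add: mesh_node_le_iff)
    then show ?thesis
      using assms(3,4) by (auto simp: indicator_def)
  qed
  then have "backward_diff a b P u y = (\<Sum>n\<in>{Suc j}. (u (mesh_node a b P n) - u (mesh_node a b P (n - 1))) *
               indicat_real {mesh_node a b P (n - 1)<..<mesh_node a b P n} y)"
    unfolding backward_diff_def using assms(2) by (intro sum.mono_neutral_right) auto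
  then show ?thesis
    using assms by simp
qed

lemma bounded_measurable_backward_diff: "bounded_measurable S (backward_diff a b P u)"
  unfolding backward_diff_def
  by (intro bounded_measurable_sum bounded_measurable_cmult bounded_measurable_indicator) simp

section \<open>The error of the slope\<close>

definition slope_error :: "real \<Rightarrow> real \<Rightarrow> nat \<Rightarrow> (real \<Rightarrow> real) \<Rightarrow> (real \<Rightarrow> real) \<Rightarrow> real \<Rightarrow> real" where
  "slope_error a b P u u' y = u' y - backward_diff a b P u y / mesh_size a b P"

lemma bounded_measurable_slope_error:
  assumes "bounded_measurable S u'"
  shows "bounded_measurable S (slope_error a b P u u')"
proof -
  have "slope_error a b P u u'
      = (\<lambda>z. u' z + (- 1 / mesh_size a b P) * backward_diff a b P u z)"
    by (auto simp: slope_error_def)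
  then show ?thesis
    by (simp only: bounded_measurable_add bounded_measurable_cmult
        bounded_measurable_backward_diff assms)
qed

lemma RL_integral_right_slope_error:
  assumes "0 < \<beta>" "a \<le> x" "x \<le> b" "bounded_measurable {a..b} u'"
  shows "RL_integral_right b \<beta> (slope_error a b P u u') x
    = RL_integral_right b \<beta> u' x - RL_integral_right b \<beta> (backward_diff a b P u) x / mesh_size a b P"
proof -
  have "slope_error a b P u u'
      = (\<lambda>z. u' z + (- 1 / mesh_size a b P) * backward_diff a b P u z)"
    by (auto simp: slope_error_def)
  then have "RL_integral_right b \<beta> (slope_error a b P u u') x = RL_integral_right b \<beta> u' x
      + RL_integral_right b \<beta> (\<lambda>z. (- 1 / mesh_size a b P) * backward_diff a b P u z) x"
    by (simp only: RL_integral_right_add[OF assms] bounded_measurable_cmult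
        bounded_measurable_backward_diff)
  then show ?thesis
    by (simp only: RL_integral_right_cmult) simp
qed

text \<open>
  On each cell the backward difference divided by the mesh size is a value of \<open>u'\<close> in that cell, by
  the mean value theorem.
\<close>

lemma slope_error_bound:
  assumes "a < b" "0 < P" "y \<in> {a..b}" "y \<notin> mesh_node a b P ` {..P}"
    and der: "\<And>z. z \<in> {a..b} \<Longrightarrow> (u has_real_derivative u' z) (at z within {a..b})"
    and lip: "M-lipschitz_on {a..b} u'"
  shows "\<bar>slope_error a b P u u' y\<bar> \<le> M * mesh_size a b P"
proof -
  obtain j where j: "j < P" "mesh_node a b P j < y" "y < mesh_node a b P (Suc j)"
    using mesh_cell_exists assms by blast
  define p where "p = mesh_node a b P j"
  define h where "h = mesh_size a b P"
  have h: "0 < h"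
    using assms by (simp add: h_def mesh_size_pos)
  have "a \<le> p" "p + h \<le> b"
    using mesh_node_le_iff[of a b P 0 j] mesh_node_le_iff[of a b P "Suc j" P] j assms
    by (simp_all add: p_def h_def mesh_node_0 mesh_node_P flip: mesh_node_Suc)
  have sub: "{p..p + h} \<subseteq> {a..b}" and y: "y \<in> {p..p + h}"
    using \<open>a \<le> p\<close> \<open>p + h \<le> b\<close> j by (auto simp: p_def h_def mesh_node_Suc)
  have "\<bar>u' y - (u (p + h) - u p) / h\<bar> \<le> M * h"
  proof (rule divided_difference_error[OF h y])
    show "(u has_real_derivative u' z) (at z within {p..p + h})" if "z \<in> {p..p + h}" for z
      using der[of z] that sub by (auto intro: has_field_derivative_subset)
    show "\<bar>u' y - u' z\<bar> \<le> M * h" if "z \<in> {p..p + h}" for z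
    proof -
      have "\<bar>u' y - u' z\<bar> \<le> M * \<bar>y - z\<bar>"
        using lipschitz_onD[OF lip, of y z] that sub y by (auto simp: dist_real_def)
      also have "\<dots> \<le> M * h"
        using that y lipschitz_on_nonneg[OF lip] by (intro mult_left_mono) auto
      finally show ?thesis .
    qed
  qed
  then show ?thesis
    using backward_diff_cell[OF assms(1) j] by (simp add: slope_error_def p_def h_def mesh_node_Suc)
qed

text \<open>
  On a cell, the difference of the slope errors at \<open>y + h\<close> and \<open>y\<close> is the slope error of the
  function \<open>z \<mapsto> u (z + h) - u z\<close>. Its derivative is the increment of \<open>u'\<close>, which has Lipschitz
  constant \<open>M h\<close>, and so the mean value argument for a single cell gains a second factor \<open>h\<close>.
\<close>

lemma slope_error_shift_bound:
  assumes "a < b" "0 < P" "y \<in> {a..b - mesh_size a b P}" "y \<notin> mesh_node a b P ` {..P}"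
    and der: "\<And>z. z \<in> {a..b} \<Longrightarrow> (u has_real_derivative u' z) (at z within {a..b})"
    and der2: "\<And>z. z \<in> {a..b} \<Longrightarrow> (u' has_real_derivative u'' z) (at z within {a..b})"
    and lip: "M-lipschitz_on {a..b} u''"
  shows "\<bar>slope_error a b P u u' (y + mesh_size a b P) - slope_error a b P u u' y\<bar>
    \<le> M * (mesh_size a b P)\<^sup>2"
proof -
  define h where "h = mesh_size a b P"
  have h: "0 < h"
    using assms by (simp add: h_def mesh_size_pos)
  obtain j where j: "j < P" "mesh_node a b P j < y" "y < mesh_node a b P (Suc j)"
    using mesh_cell_exists[of a b P y] assms h by (auto simp: h_def)
  define p where "p = mesh_node a b P j"
  \<comment> \<open>The cell of \<open>y\<close> is not the last one, so \<open>y + h\<close> lies in the next cell.\<close>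
  have "mesh_node a b P (Suc j) < mesh_node a b P P"
    using j(2) assms(2,3) by (simp add: mesh_node_P mesh_node_Suc)
  then have Sj: "Suc j < P"
    using assms by (simp add: mesh_node_less_iff)
  have "a \<le> p" "p + h + h \<le> b"
    using mesh_node_le_iff[of a b P 0 j] mesh_node_le_iff[of a b P "Suc (Suc j)" P] Sj assms
    by (simp_all add: p_def h_def mesh_node_0 mesh_node_P flip: mesh_node_Suc)
  have y: "y \<in> {p..p + h}"
    using j by (auto simp: p_def h_def mesh_node_Suc)
  have main: "\<bar>(u' (y + h) - u' y) - ((u (p + h + h) - u (p + h)) - (u (p + h) - u p)) / h\<bar> \<le> M * h * h"
  proof (rule divided_difference_error[OF h y, of "\<lambda>z. u (z + h) - u z" "\<lambda>z. u' (z + h) - u' z"])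
    show "((\<lambda>z. u (z + h) - u z) has_real_derivative u' (z + h) - u' z) (at z within {p..p + h})"
      if "z \<in> {p..p + h}" for z
    proof (rule DERIV_diff)
      show "(u has_real_derivative u' z) (at z within {p..p + h})"
        using der[of z] that \<open>a \<le> p\<close> \<open>p + h + h \<le> b\<close> h
        by (auto intro: has_field_derivative_subset)
      have "(u has_real_derivative u' (z + h)) (at (z + h) within (\<lambda>z. z + h) ` {p..p + h})"
        using der[of "z + h"] that \<open>a \<le> p\<close> \<open>p + h + h \<le> b\<close> h
        by (auto intro: has_field_derivative_subset)
      then show "((\<lambda>z. u (z + h)) has_real_derivative u' (z + h)) (at z within {p..p + h})"
        by (rule DERIV_image_chain[where g = "\<lambda>z. z + h" and Db = 1, unfolded o_def, simplified])
          (auto intro!: derivative_eq_intros)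
    qed
    show "\<bar>(u' (y + h) - u' y) - (u' (z + h) - u' z)\<bar> \<le> M * h * h" if z: "z \<in> {p..p + h}" for z
    proof -
      have *: "\<bar>(u' (q + h) - u' q) - (u' (r + h) - u' r)\<bar> \<le> M * h * h"
        if "r \<le> q" "r \<in> {p..p + h}" "q \<in> {p..p + h}" for q r
      proof -
        have "\<bar>(u' (q + h) - u' q) - (u' (r + h) - u' r)\<bar> \<le> M * h * (q - r)"
        proof (rule shift_difference_bound[OF \<open>r \<le> q\<close>])
          show "continuous_on {r..q + h} u'"
            using that \<open>a \<le> p\<close> \<open>p + h + h \<le> b\<close>
            by (intro continuous_on_subset[OF DERIV_continuous_on[OF der2]]) auto
          show "(u' has_real_derivative u'' s) (at s)" if "r < s" "s < q + h" for s
            using der2[of s] that \<open>r \<in> {p..p + h}\<close> \<open>q \<in> {p..p + h}\<close> \<open>a \<le> p\<close> \<open>p + h + h \<le> b\<close>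
            by (simp add: at_within_Icc_at)
          show "M-lipschitz_on {r<..<q + h} u''"
            using that \<open>a \<le> p\<close> \<open>p + h + h \<le> b\<close> by (intro lipschitz_on_subset[OF lip]) auto
        qed (use h in simp)
        also have "\<dots> \<le> M * h * h"
          using that h lipschitz_on_nonneg[OF lip] by (intro mult_left_mono) auto
        finally show ?thesis .
      qed
      show ?thesis
        using *[of z y] *[of y z] y z by (cases "z \<le> y") (auto simp: abs_minus_commute)
    qed
  qed
  have "backward_diff a b P u y = u (p + h) - u p"
    using backward_diff_cell[OF assms(1) j] by (simp add: p_def h_def mesh_node_Suc)
  moreover have "backward_diff a b P u (y + h) = u (p + h + h) - u (p + h)"
    using backward_diff_cell[OF assms(1) Sj, of "y + h"] j by (simp add: p_def h_def mesh_node_Suc)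
  ultimately have "slope_error a b P u u' (y + h) - slope_error a b P u u' y
      = (u' (y + h) - u' y) - ((u (p + h + h) - u (p + h)) - (u (p + h) - u p)) / h"
    by (simp add: slope_error_def diff_divide_distrib add_divide_distrib flip: h_def)
  with main show ?thesis
    by (simp add: power2_eq_square mult.assoc flip: h_def)
qed

section \<open>The truncation error\<close>

theorem theorem2:
  fixes \<alpha> a b c0 c1 :: real and \<kappa> u f :: "real \<Rightarrow> real"
  assumes alpha: "0 < \<alpha>" "\<alpha> < 1"
    and ab: "a < b"
    and c_pos: "0 < c0" "0 < c1"
    and kappa_bounds: "\<And>x. x \<in> {a<..<b} \<Longrightarrow> c0 \<le> \<kappa> x \<and> \<kappa> x \<le> c1"
    and equation: "\<And>x. x \<in> {a<..<b} \<Longrightarrow>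
        ((\<lambda>y. \<kappa> y * RL_deriv_right b \<alpha> u y) has_real_derivative - f x) (at x)"
    and boundary: "u a = 0" "u b = 0"
    and f_C1: "Ck_on 1 f {a..b}"
    and kappa_C2: "Ck_on 2 \<kappa> {a..b}"
    and u_C3: "Ck_on 3 u {a..b}"
  shows "(\<exists>C. \<forall>P\<ge>2. \<forall>n\<in>{1..P - 1}.
            \<bar>truncation_error \<alpha> a b \<kappa> u P n\<bar>
              \<le> C * mesh_size a b P * (1 + (b - mesh_node a b P (n - 1)) powr (- \<alpha>)))
       \<and> (\<forall>d>0. \<exists>C. \<forall>P\<ge>2. \<forall>n\<in>{1..P - 1}. b - mesh_node a b P n \<ge> d \<longrightarrow>
            \<bar>truncation_error \<alpha> a b \<kappa> u P n\<bar> \<le> C * mesh_size a b P)"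
proof -
  let ?I = "RL_integral_right b (1 - \<alpha>)"
  have \<beta>: "0 < 1 - \<alpha>" "1 - \<alpha> \<le> 1"
    using alpha by auto
  obtain u' where u': "\<And>x. x \<in> {a..b} \<Longrightarrow> (u has_real_derivative u' x) (at x within {a..b})"
    "Ck_on (Suc 1) u' {a..b}"
    using Ck_on_derivative[of 2 u "{a..b}"] u_C3 by (auto simp: eval_nat_numeral)
  obtain u'' where u'': "\<And>x. x \<in> {a..b} \<Longrightarrow> (u' has_real_derivative u'' x) (at x within {a..b})"
    "Ck_on (Suc 0) u'' {a..b}"
    using Ck_on_derivative[OF u'(2)] by auto
  obtain \<kappa>' where \<kappa>': "\<And>x. x \<in> {a..b} \<Longrightarrow> (\<kappa> has_real_derivative \<kappa>' x) (at x within {a..b})"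
    "Ck_on (Suc 0) \<kappa>' {a..b}"
    using Ck_on_derivative[of 1 \<kappa> "{a..b}"] kappa_C2 by (auto simp: eval_nat_numeral)
  have bl: "bounded_lipschitz {a..b} u'" "bounded_lipschitz {a..b} u''"
    "bounded_lipschitz {a..b} \<kappa>" "bounded_lipschitz {a..b} \<kappa>'" "bounded_lipschitz {a..b} f"
    using u'(2) u''(2) \<kappa>'(2) kappa_C2 f_C1
    by (auto intro: Ck_on_Suc_bounded_lipschitz simp: eval_nat_numeral)
  define w where "w = ?I u'"
  have RL_deriv: "RL_deriv_right b \<alpha> u x = w x" if "x \<in> {a<..<b}" for x
    unfolding RL_deriv_right_def w_def using that boundary u'(1) bl \<beta>
    by (intro DERIV_imp_deriv RL_integral_right_has_derivative) auto
  have G: "((\<lambda>y. \<kappa> y * w y) has_real_derivative - f x) (at x)" if "x \<in> {a<..<b}" for x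
    by (rule has_field_derivative_transform_within_open[OF equation[OF that], of "{a<..<b}"])
      (use that RL_deriv in auto)
  \<comment> \<open>The equation makes \<open>w\<close> as regular up to \<open>b\<close> as the data allow.\<close>
  obtain w' where w': "\<And>x. x \<in> {a<..<b} \<Longrightarrow> (w has_real_derivative w' x) (at x)"
    "bounded_lipschitz {a<..<b} w'"
  proof (rule quotient_derivative_lipschitz[of c0 a b \<kappa> \<kappa>' "\<lambda>y. \<kappa> y * w y" "\<lambda>x. - f x" w])
    show "(\<kappa> has_real_derivative \<kappa>' x) (at x)" if "x \<in> {a<..<b}" for x
      using \<kappa>'(1)[of x] that by (simp add: at_within_Icc_at)
  qed (use c_pos kappa_bounds G bl in \<open>auto intro: bounded_lipschitz_minus bounded_lipschitz_subset\<close>)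
  obtain M1 where M1: "M1-lipschitz_on {a..b} u'" "\<And>x. x \<in> {a..b} \<Longrightarrow> \<bar>u' x\<bar> \<le> M1"
    using bounded_lipschitzE bl(1) by blast
  obtain M2 where M2: "M2-lipschitz_on {a..b} u''"
    using bounded_lipschitzE bl(2) by blast
  obtain K where K: "K-lipschitz_on {a..b} \<kappa>"
    using bounded_lipschitzE bl(3) by blast
  obtain F where F: "F-lipschitz_on {a..b} f"
    using bounded_lipschitzE bl(5) by blast
  obtain L where L: "L-lipschitz_on {a<..<b} w'" "\<And>x. x \<in> {a<..<b} \<Longrightarrow> \<bar>w' x\<bar> \<le> L"
    using bounded_lipschitzE w'(2) by blast
  note nonneg = M1(1)[THEN lipschitz_on_nonneg] M2[THEN lipschitz_on_nonneg]
    K[THEN lipschitz_on_nonneg] F[THEN lipschitz_on_nonneg] L(1)[THEN lipschitz_on_nonneg]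
  have meas: "bounded_measurable {a..b} u'"
    using M1 by (intro bounded_measurable_continuous lipschitz_on_continuous_on)
  have w_cont: "continuous_on {p..q} w" if "a \<le> p" "q < b" for p q
    unfolding w_def
    using RL_integral_right_lipschitz[OF \<beta> \<open>q < b\<close> M1] that
    by (intro continuous_on_subset[OF lipschitz_on_continuous_on]) auto
  \<comment> \<open>\<open>\<Phi>\<close> bounds the mass of the kernel, and \<open>\<gamma>\<close> relates its value at \<open>b - x\<^sub>n\<close> to the
    weight \<open>(b - x\<^bsub>n-1\<^esub>)\<^sup>-\<^sup>\<alpha>\<close>.\<close>
  define \<Phi> where "\<Phi> = frac_kernel (1 - \<alpha> + 1) (b - a)"
  have \<Phi>: "0 \<le> \<Phi>"
    using \<beta> by (simp add: \<Phi>_def frac_kernel_nonneg)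
  define \<gamma> where "\<gamma> = 2 / Gamma (1 - \<alpha>)"
  have \<gamma>: "0 < \<gamma>"
    using \<beta> by (simp add: \<gamma>_def)
  define C where "C = F + c1 * (L + M2 * \<Phi> + M1 * \<gamma>) + K * (L + M1 * \<Phi>)"
  have C: "0 \<le> C"
    using nonneg c_pos \<Phi> \<gamma> by (simp add: C_def)
  have bound: "\<bar>truncation_error \<alpha> a b \<kappa> u P n\<bar>
      \<le> C * mesh_size a b P * (1 + (b - mesh_node a b P (n - 1)) powr (- \<alpha>))"
    if P: "P \<ge> 2" and n: "n \<in> {1..P - 1}" for P n
  proof -
    obtain m where m: "n = Suc m" "Suc m < P"
      using P n by (cases n) auto
    define h where "h = mesh_size a b P"
    define p where "p = mesh_node a b P m"
    have h: "0 < h"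
      using ab P by (simp add: h_def mesh_size_pos)
    have p: "a \<le> p" "p + h + h \<le> b"
      using mesh_node_le_iff[of a b P 0 m] mesh_node_le_iff[of a b P "Suc (Suc m)" P] m ab P
      by (simp_all add: p_def h_def mesh_node_0 mesh_node_P flip: mesh_node_Suc)
    have node: "mesh_node a b P m = p" "mesh_node a b P n = p + h"
      "mesh_mid a b P m = p + h / 2" "mesh_mid a b P n = p + h + h / 2"
      by (simp_all add: m p_def h_def mesh_node_Suc mesh_mid_def field_simps)
    have "p + h < b"
      using p h by simp
    let ?E = "slope_error a b P u u'"
    let ?N = "mesh_node a b P ` {..P}"
    define Ip where "Ip = ?I (backward_diff a b P u) p"
    define Iq where "Iq = ?I (backward_diff a b P u) (p + h)"
    \<comment> \<open>\<open>p = x\<^bsub>n-1\<^esub>\<close>, and \<open>e1\<close>, \<open>e2\<close> are the errors \<open>E\<^bsub>n-1\<^esub>\<close>, \<open>E\<^sub>n\<close> of the fractional derivative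
      at the two midpoints.\<close>
    define e1 where "e1 = w (p + h / 2) - Ip / h"
    define e2 where "e2 = w (p + h + h / 2) - Iq / h"
    have E1: "?I ?E p = w p - Ip / h" and E2: "?I ?E (p + h) = w (p + h) - Iq / h"
      using p h by (simp_all add: RL_integral_right_slope_error[OF \<beta>(1) _ _ meas] w_def Ip_def Iq_def h_def)
    have measE: "bounded_measurable {a..b} ?E"
      using meas by (rule bounded_measurable_slope_error)
    have E_bound: "\<bar>?E z\<bar> \<le> M1 * h" if "z \<in> {a..b} - ?N" for z
      unfolding h_def using that P
      by (intro slope_error_bound[OF ab _ _ _ u'(1) M1(1)]) auto
    have "\<bar>?I ?E p\<bar> \<le> (M1 * h) * \<Phi>"
      unfolding \<Phi>_def using p h nonneg
      by (intro RL_integral_right_bound[OF \<beta>(1) _ _ measE _ _ E_bound]) auto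
    moreover have "\<bar>w (p + h / 2) - w p\<bar> \<le> L * h"
    proof -
      obtain z where z: "p < z" "z < p + h / 2" "w (p + h / 2) - w p = (p + h / 2 - p) * w' z"
      proof (rule mean_value_interior[of p "p + h / 2" w w'])
        show "(w has_real_derivative w' z) (at z)" if "p < z" "z < p + h / 2" for z
          using that p h by (intro w') auto
      qed (use p h in \<open>auto intro: w_cont\<close>)
      have "\<bar>w (p + h / 2) - w p\<bar> = (h / 2) * \<bar>w' z\<bar>"
        unfolding z(3) using h by (simp add: abs_mult)
      also have "\<dots> \<le> h * L"
        using z p h by (intro mult_mono L) auto
      finally show ?thesis
        by (simp add: mult.commute)
    qed
    ultimately have e1: "\<bar>e1\<bar> \<le> h * (L + M1 * \<Phi>)"
      using E1 by (simp add: e1_def algebra_simps)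
    define r where "r = (b - p) powr (- \<alpha>)"
    have r: "0 \<le> r"
      by (simp add: r_def)
    have "\<bar>?I ?E (p + h) - ?I ?E p\<bar>
        \<le> (M2 * h\<^sup>2) * frac_kernel (1 - \<alpha> + 1) (b - a) + (M1 * h) * h * frac_kernel (1 - \<alpha>) (b - h - p)"
    proof (rule RL_integral_right_shift_bound[OF \<beta> _ _ _ measE measE, where N = ?N])
      show "\<bar>?E (z + h) - ?E z\<bar> \<le> M2 * h\<^sup>2" if "z \<in> {p..b - h} - ?N" for z
        unfolding h_def using that P p
        by (intro slope_error_shift_bound[OF ab _ _ _ u'(1) u''(1) M2]) (auto simp: h_def)
      show "\<bar>?E z\<bar> \<le> M1 * h" if "z \<in> {b - h..b} - ?N" for z
        using that p h by (intro E_bound) auto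
    qed (use p h nonneg in auto)
    also have "\<dots> \<le> (M2 * h\<^sup>2) * \<Phi> + (M1 * h) * h * (\<gamma> * r)"
      unfolding \<Phi>_def \<gamma>_def r_def using alpha p h nonneg
      by (intro add_left_mono mult_left_mono frac_kernel_distance_doubling) auto
    also have "\<dots> = h\<^sup>2 * (M2 * \<Phi> + M1 * (\<gamma> * r))"
      by (simp add: power2_eq_square algebra_simps)
    finally have "\<bar>?I ?E (p + h) - ?I ?E p\<bar> \<le> h\<^sup>2 * (M2 * \<Phi> + M1 * (\<gamma> * r))" .
    moreover have "\<bar>(w (p + h + h / 2) - w (p + h)) - (w (p + h / 2) - w p)\<bar> \<le> L * (h / 2) * (p + h - p)"
    proof (rule shift_difference_bound)
      show "(w has_real_derivative w' z) (at z)" if "p < z" "z < p + h + h / 2" for z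
        using that p h by (intro w') auto
      show "L-lipschitz_on {p<..<p + h + h / 2} w'"
        using p h by (intro lipschitz_on_subset[OF L(1)]) auto
    qed (use p h in \<open>auto intro!: w_cont\<close>)
    moreover have "L * (h / 2) * (p + h - p) \<le> h\<^sup>2 * L"
      using nonneg h by (simp add: power2_eq_square)
    moreover have "e2 - e1 = ((w (p + h + h / 2) - w (p + h)) - (w (p + h / 2) - w p))
        + (?I ?E (p + h) - ?I ?E p)"
      by (simp add: E1 E2 e1_def e2_def)
    ultimately have "\<bar>e2 - e1\<bar> \<le> h\<^sup>2 * L + h\<^sup>2 * (M2 * \<Phi> + M1 * (\<gamma> * r))"
      by linarith
    then have e21: "\<bar>e2 - e1\<bar> \<le> h\<^sup>2 * (L + M2 * \<Phi> + M1 * (\<gamma> * r))"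
      by (simp add: distrib_left)
    have "\<bar>\<kappa> (p + h + h / 2) - \<kappa> (p + h / 2)\<bar> \<le> K * h"
      using lipschitz_onD[OF K, of "p + h + h / 2" "p + h / 2"] p h by (auto simp: dist_real_def)
    moreover have "\<bar>\<kappa> (p + h + h / 2)\<bar> \<le> c1"
      using kappa_bounds[of "p + h + h / 2"] c_pos p h by auto
    ultimately have flux: "\<bar>\<kappa> (p + h + h / 2) * e2 - \<kappa> (p + h / 2) * e1\<bar>
        \<le> c1 * (h\<^sup>2 * (L + M2 * \<Phi> + M1 * (\<gamma> * r))) + (K * h) * (h * (L + M1 * \<Phi>))"
      using e1 e21 by (intro product_difference_bound)
    \<comment> \<open>The midpoints are one mesh size apart and \<open>x\<^sub>n = p + h\<close> lies between them.\<close>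
    define G where "G = (\<lambda>y. \<kappa> y * w y)"
    have mid_add: "p + h / 2 + h = p + h + h / 2"
      by simp
    have diff: "\<bar>- f (p + h) - (G (p + h + h / 2) - G (p + h / 2)) / h\<bar> \<le> F * h"
    proof (rule divided_difference_error[of h "p + h" "p + h / 2" G "\<lambda>z. - f z", unfolded mid_add])
      show "(G has_real_derivative - f z) (at z within {p + h / 2..p + h + h / 2})"
        if "z \<in> {p + h / 2..p + h + h / 2}" for z
        unfolding G_def by (rule has_field_derivative_at_within[OF G]) (use that p h in auto)
      show "\<bar>- f (p + h) - - f z\<bar> \<le> F * h" if "z \<in> {p + h / 2..p + h + h / 2}" for z
      proof -
        have "\<bar>f (p + h) - f z\<bar> \<le> F * \<bar>p + h - z\<bar>"
          using lipschitz_onD[OF F, of "p + h" z] that p h by (auto simp: dist_real_def)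
        also have "\<dots> \<le> F * h"
          using that nonneg h by (intro mult_left_mono) auto
        finally show ?thesis
          by (simp add: abs_minus_commute)
      qed
    qed (use h in auto)
    have "deriv (\<lambda>x. \<kappa> x * RL_deriv_right b \<alpha> u x) (p + h) = - f (p + h)"
      using p h by (intro DERIV_imp_deriv equation) auto
    then have "truncation_error \<alpha> a b \<kappa> u P n = - f (p + h)
        - 1 / h\<^sup>2 * (\<kappa> (p + h + h / 2) * Iq - \<kappa> (p + h / 2) * Ip)"
      using node m by (simp add: truncation_error_def Ip_def Iq_def flip: h_def)
    also have "\<dots> = (- f (p + h) - (G (p + h + h / 2) - G (p + h / 2)) / h)
        + (\<kappa> (p + h + h / 2) * e2 - \<kappa> (p + h / 2) * e1) / h"
      using h by (simp add: G_def e1_def e2_def field_simps power2_eq_square)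
    finally have "\<bar>truncation_error \<alpha> a b \<kappa> u P n\<bar> \<le> F * h
        + \<bar>(\<kappa> (p + h + h / 2) * e2 - \<kappa> (p + h / 2) * e1) / h\<bar>"
      using diff by linarith
    also have "\<bar>(\<kappa> (p + h + h / 2) * e2 - \<kappa> (p + h / 2) * e1) / h\<bar>
        \<le> (c1 * (h\<^sup>2 * (L + M2 * \<Phi> + M1 * (\<gamma> * r))) + (K * h) * (h * (L + M1 * \<Phi>))) / h"
      using flux h by (simp add: divide_right_mono)
    also have "F * h + \<dots> = h * (F + c1 * (L + M2 * \<Phi> + M1 * (\<gamma> * r)) + K * (L + M1 * \<Phi>))"
      using h by (simp add: field_simps power2_eq_square)
    also have "\<dots> \<le> h * (C * (1 + r))"
    proof (rule mult_left_mono)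
      have "C * (1 + r) = F + c1 * (L + M2 * \<Phi> + M1 * (\<gamma> * r)) + K * (L + M1 * \<Phi>)
          + (c1 * M1 * \<gamma> + r * (F + c1 * (L + M2 * \<Phi>) + K * (L + M1 * \<Phi>)))"
        by (simp add: C_def algebra_simps)
      moreover have "0 \<le> c1 * M1 * \<gamma> + r * (F + c1 * (L + M2 * \<Phi>) + K * (L + M1 * \<Phi>))"
        using nonneg c_pos \<Phi> \<gamma> r by (intro add_nonneg_nonneg mult_nonneg_nonneg) auto
      ultimately show "F + c1 * (L + M2 * \<Phi> + M1 * (\<gamma> * r)) + K * (L + M1 * \<Phi>) \<le> C * (1 + r)"
        by linarith
    qed (use h in simp)
    finally show ?thesis
      using node m by (simp add: r_def h_def mult_ac)
  qed
  have far: "\<bar>truncation_error \<alpha> a b \<kappa> u P n\<bar> \<le> (C * (1 + d powr (- \<alpha>))) * mesh_size a b P"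
    if d: "d > 0" and P: "P \<ge> 2" and n: "n \<in> {1..P - 1}" and dist: "b - mesh_node a b P n \<ge> d"
    for d P n
  proof -
    have "mesh_node a b P (n - 1) \<le> mesh_node a b P n"
      using ab P by (simp add: mesh_node_le_iff)
    then have "(b - mesh_node a b P (n - 1)) powr (- \<alpha>) \<le> d powr (- \<alpha>)"
      using d dist alpha by (intro powr_mono2') auto
    then have "C * mesh_size a b P * (1 + (b - mesh_node a b P (n - 1)) powr (- \<alpha>))
        \<le> C * mesh_size a b P * (1 + d powr (- \<alpha>))"
      using C ab P mesh_size_pos[of a b P] by (intro mult_left_mono) auto
    with bound[OF P n] show ?thesis
      by (simp add: mult_ac)
  qed
  show ?thesis
    using bound far by blast
qed

end
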